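(* For every $L$-algebra $X$ and every pair $I,J$ of ideals of $X$, one has $[I,J]=I\cap J$.
   Context: An $L$-algebra is a set $X$ with a binary operation $(x,y)\mapsto x\cdot y$ and a constant $1\in X$ such that for all $x,y,z\in X$: (1) $x\cdot x=x\cdot 1=1$ and $1\cdot x=x$; (2) $(x\cdot y)\cdot(x\cdot z)=(y\cdot x)\cdot(y\cdot z)$; (3) $x\cdot y=y\cdot x=1$ implies $x=y$. An $L$-algebra morphism is a map $f$ with $f(x\cdot y)=f(x)\cdot f(y)$ for all $x,y$ (then automatically $f(1)=1$). An ideal of $X$ is a subset $I\subseteq X$ such that for all $x,y\in X$: $1\in I$; if $x\in I$ and $x\cdot y\in I$ then $y\in I$; if $x\in I$ then $(x\cdot y)\cdot y\in I$; if $x\in I$ then $y\cdot x\in I$; if $x\in I$ then $y\cdot(x\cdot y)\in I$. Ideals are subalgebras of $X$. For an ideal $K$ of $X$, $\sim_K$ is the congruence on $X$ defined by $x\sim_K y$ if $x\cdot y\in K$ and $y\cdot x\in K$, and $X/K$ denotes the quotient $L$-algebra $X/{\sim_K}$. For ideals $I,J$ of $X$, the commutator $[I,J]$ is the smallest ideal $K$ of $X$ for which the map $\mu\colon I\times J\to X/K$, $\mu(i,j)=[i\cdot j]_{\sim_K}$, is an $L$-algebra morphism, where $I\times J$ has the componentwise operation. *)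

theory Defs
  imports "HOL-Algebra.Congruence"
begin

record 'a l_alg = "'a partial_object" +
  ldot :: "['a, 'a] \<Rightarrow> 'a"  (infixl "\<cdot>\<index>" 70)
  lone :: "'a"  ("\<one>\<index>")

locale l_algebra =
  fixes X :: "('a, 'm) l_alg_scheme" (structure)
  assumes dot_closed: "\<lbrakk>x \<in> carrier X; y \<in> carrier X\<rbrakk> \<Longrightarrow> x \<cdot> y \<in> carrier X"
    and one_closed: "\<one> \<in> carrier X"
    and dot_self: "x \<in> carrier X \<Longrightarrow> x \<cdot> x = \<one>"
    and dot_one: "x \<in> carrier X \<Longrightarrow> x \<cdot> \<one> = \<one>"
    and one_dot: "x \<in> carrier X \<Longrightarrow> \<one> \<cdot> x = x"
    and cycloid: "\<lbrakk>x \<in> carrier X; y \<in> carrier X; z \<in> carrier X\<rbrakk>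
                    \<Longrightarrow> (x \<cdot> y) \<cdot> (x \<cdot> z) = (y \<cdot> x) \<cdot> (y \<cdot> z)"
    and antisym: "\<lbrakk>x \<in> carrier X; y \<in> carrier X; x \<cdot> y = \<one>; y \<cdot> x = \<one>\<rbrakk> \<Longrightarrow> x = y"

definition l_hom :: "('a, 'm) l_alg_scheme \<Rightarrow> ('b, 'n) l_alg_scheme \<Rightarrow> ('a \<Rightarrow> 'b) set" where
  "l_hom X Y = {f \<in> carrier X \<rightarrow> carrier Y.
     \<forall>x \<in> carrier X. \<forall>y \<in> carrier X. f (x \<cdot>\<^bsub>X\<^esub> y) = f x \<cdot>\<^bsub>Y\<^esub> f y}"

locale l_ideal = l_algebra X for X :: "('a, 'm) l_alg_scheme" (structure) +
  fixes I :: "'a set"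
  assumes subset: "I \<subseteq> carrier X"
    and one_mem: "\<one> \<in> I"
    and mp: "\<lbrakk>x \<in> carrier X; y \<in> carrier X; x \<in> I; x \<cdot> y \<in> I\<rbrakk> \<Longrightarrow> y \<in> I"
    and dot_dot_mem: "\<lbrakk>x \<in> I; y \<in> carrier X\<rbrakk> \<Longrightarrow> (x \<cdot> y) \<cdot> y \<in> I"
    and left_mem: "\<lbrakk>x \<in> I; y \<in> carrier X\<rbrakk> \<Longrightarrow> y \<cdot> x \<in> I"
    and left_dot_mem: "\<lbrakk>x \<in> I; y \<in> carrier X\<rbrakk> \<Longrightarrow> y \<cdot> (x \<cdot> y) \<in> I"

definition l_cong :: "('a, 'm) l_alg_scheme \<Rightarrow> 'a set \<Rightarrow> ('a \<times> 'a) set" where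
  "l_cong X K = {(x, y). x \<in> carrier X \<and> y \<in> carrier X
                   \<and> x \<cdot>\<^bsub>X\<^esub> y \<in> K \<and> y \<cdot>\<^bsub>X\<^esub> x \<in> K}"

text \<open>The operation takes the union of the classes of all products of representatives;
  since \<open>l_cong X K\<close> is a congruence this is a single class, see \<open>quot_dot\<close> below.\<close>
definition l_quot :: "('a, 'm) l_alg_scheme \<Rightarrow> 'a set \<Rightarrow> 'a set l_alg" where
  "l_quot X K = \<lparr> carrier = carrier X // l_cong X K,
     ldot = (\<lambda>A B. \<Union>x\<in>A. \<Union>y\<in>B. l_cong X K `` {x \<cdot>\<^bsub>X\<^esub> y}),
     lone = l_cong X K `` {\<one>\<^bsub>X\<^esub>} \<rparr>"

definition l_prod :: "('a, 'm) l_alg_scheme \<Rightarrow> 'a set \<Rightarrow> 'a set \<Rightarrow> ('a \<times> 'a) l_alg" where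
  "l_prod X I J = \<lparr> carrier = I \<times> J,
     ldot = (\<lambda>(i, j) (i', j'). (i \<cdot>\<^bsub>X\<^esub> i', j \<cdot>\<^bsub>X\<^esub> j')),
     lone = (\<one>\<^bsub>X\<^esub>, \<one>\<^bsub>X\<^esub>) \<rparr>"

definition commutes_modulo ::
    "('a, 'm) l_alg_scheme \<Rightarrow> 'a set \<Rightarrow> 'a set \<Rightarrow> 'a set \<Rightarrow> bool" where
  "commutes_modulo X I J K \<longleftrightarrow>
     (\<lambda>(i, j). l_cong X K `` {i \<cdot>\<^bsub>X\<^esub> j}) \<in> l_hom (l_prod X I J) (l_quot X K)"

text \<open>Smallest with respect to inclusion; existence is \<open>commutator_least\<close> below.\<close>
definition commutator :: "('a, 'm) l_alg_scheme \<Rightarrow> 'a set \<Rightarrow> 'a set \<Rightarrow> 'a set" where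
  "commutator X I J = (LEAST K. l_ideal X K \<and> commutes_modulo X I J K)"

lemma (in l_ideal) equiv_cong: "equiv (carrier X) (l_cong X I)"
proof (rule equivI)
  show "l_cong X I \<subseteq> carrier X \<times> carrier X" by (auto simp: l_cong_def)
  show "refl_on (carrier X) (l_cong X I)"
    by (auto simp: refl_on_def l_cong_def dot_self one_mem)
  show "sym (l_cong X I)" by (auto simp: sym_def l_cong_def)
  have tr: "x \<cdot> z \<in> I" if "x \<in> carrier X" "y \<in> carrier X" "z \<in> carrier X" "x \<cdot> y \<in> I" "y \<cdot> z \<in> I"
    for x y z
  proof -
    have "(x \<cdot> y) \<cdot> (x \<cdot> z) \<in> I"
      using that by (simp add: cycloid[of x y z] left_mem dot_closed)
    then show ?thesis using that mp dot_closed by blast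
  qed
  show "trans (l_cong X I)" unfolding trans_def l_cong_def using tr by blast
qed

lemma (in l_ideal) cong_dot:
  assumes "(x, x') \<in> l_cong X I" "(y, y') \<in> l_cong X I"
  shows "(x \<cdot> y, x' \<cdot> y') \<in> l_cong X I"
proof -
  have tr: "(a, c) \<in> l_cong X I" if "(a, b) \<in> l_cong X I" "(b, c) \<in> l_cong X I" for a b c
    using equiv_cong that by (meson equivE transE)
  have sy: "(b, a) \<in> l_cong X I" if "(a, b) \<in> l_cong X I" for a b
    using that by (auto simp: l_cong_def)
  have C: "x \<in> carrier X" "x' \<in> carrier X" "y \<in> carrier X" "y' \<in> carrier X"
    and M: "x \<cdot> x' \<in> I" "x' \<cdot> x \<in> I" "y \<cdot> y' \<in> I" "y' \<cdot> y \<in> I"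
    using assms by (auto simp: l_cong_def)
  have "(x \<cdot> y) \<cdot> (x \<cdot> y') \<in> I" "(x \<cdot> y') \<cdot> (x \<cdot> y) \<in> I"
    using C M by (simp_all add: cycloid[of x y y'] cycloid[of x y' y] left_mem dot_closed)
  then have 1: "(x \<cdot> y, x \<cdot> y') \<in> l_cong X I"
    using C by (simp add: l_cong_def dot_closed)
  have a: "(u, t \<cdot> u) \<in> l_cong X I" if "t \<in> I" "u \<in> carrier X" for t u
    using that subset dot_dot_mem left_dot_mem by (auto simp: l_cong_def dot_closed subset_iff)
  have "(x \<cdot> y', (x \<cdot> x') \<cdot> (x \<cdot> y')) \<in> l_cong X I"
       "((x' \<cdot> x) \<cdot> (x' \<cdot> y'), x' \<cdot> y') \<in> l_cong X I"
    using C M a sy dot_closed by blast+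
  then have "(x \<cdot> y', x' \<cdot> y') \<in> l_cong X I"
    using C tr by (simp add: cycloid[of x x' y'])
  with 1 tr show ?thesis by blast
qed

lemma (in l_ideal) quot_dot:
  assumes "x \<in> carrier X" "y \<in> carrier X"
  shows "(l_cong X I `` {x}) \<cdot>\<^bsub>l_quot X I\<^esub> (l_cong X I `` {y}) = l_cong X I `` {x \<cdot> y}"
proof -
  have "congruent2 (l_cong X I) (l_cong X I) (\<lambda>x y. l_cong X I `` {x \<cdot> y})"
    unfolding congruent2_def using cong_dot equiv_class_eq[OF equiv_cong] by fastforce
  from UN_equiv_class2[OF equiv_cong equiv_cong this assms]
  show ?thesis by (simp add: l_quot_def)
qed

lemma (in l_ideal) class_eq_iff:
  assumes "x \<in> carrier X" "y \<in> carrier X"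
  shows "l_cong X I `` {x} = l_cong X I `` {y} \<longleftrightarrow> x \<cdot> y \<in> I \<and> y \<cdot> x \<in> I"
  using eq_equiv_class_iff[OF equiv_cong assms] assms by (simp add: l_cong_def)

lemma (in l_ideal) l_algebra_quot: "l_algebra (l_quot X I)"
proof -
  let ?c = "\<lambda>x. l_cong X I `` {x}"
  have car: "carrier (l_quot X I) = ?c ` carrier X"
    by (auto simp: l_quot_def quotient_def)
  have one: "\<one>\<^bsub>l_quot X I\<^esub> = ?c \<one>" by (simp add: l_quot_def)
  have one_iff: "?c x = ?c \<one> \<longleftrightarrow> x \<in> I" if "x \<in> carrier X" for x
    using that by (simp add: class_eq_iff one_closed dot_one one_dot one_mem)
  show ?thesis
  proof
    fix A B C
    assume "A \<in> carrier (l_quot X I)" "B \<in> carrier (l_quot X I)" "C \<in> carrier (l_quot X I)"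
    then obtain x y z where x: "x \<in> carrier X" "A = ?c x" and y: "y \<in> carrier X" "B = ?c y"
      and z: "z \<in> carrier X" "C = ?c z"
      unfolding car by blast
    then show "(A \<cdot>\<^bsub>l_quot X I\<^esub> B) \<cdot>\<^bsub>l_quot X I\<^esub> (A \<cdot>\<^bsub>l_quot X I\<^esub> C)
             = (B \<cdot>\<^bsub>l_quot X I\<^esub> A) \<cdot>\<^bsub>l_quot X I\<^esub> (B \<cdot>\<^bsub>l_quot X I\<^esub> C)"
      by (simp add: quot_dot dot_closed cycloid[of x y z])
  next
    fix A B
    assume "A \<in> carrier (l_quot X I)" "B \<in> carrier (l_quot X I)"
      and AB: "A \<cdot>\<^bsub>l_quot X I\<^esub> B = \<one>\<^bsub>l_quot X I\<^esub>" "B \<cdot>\<^bsub>l_quot X I\<^esub> A = \<one>\<^bsub>l_quot X I\<^esub>"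
    then obtain x y where x: "x \<in> carrier X" "A = ?c x" and y: "y \<in> carrier X" "B = ?c y"
      unfolding car by blast
    with AB show "A = B"
      by (simp add: quot_dot one one_iff class_eq_iff dot_closed)
  qed (unfold car one, auto simp: quot_dot dot_closed one_closed dot_self dot_one one_dot)
qed

lemma l_algebra_prod:
  assumes "l_ideal X I" "l_ideal X J"
  shows "l_algebra (l_prod X I J)"
proof -
  interpret I: l_ideal X I by fact
  interpret J: l_ideal X J by fact
  show ?thesis
    by unfold_locales
       (use I.subset J.subset in \<open>auto simp: l_prod_def I.left_mem J.left_mem I.one_mem J.one_mem
          I.dot_self I.dot_one I.one_dot subset_iff intro: I.cycloid I.antisym\<close>)
qed

lemma commutes_modulo_iff:
  assumes "l_ideal X I" "l_ideal X J" "l_ideal X K"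
  shows "commutes_modulo X I J K \<longleftrightarrow>
    (\<forall>i\<in>I. \<forall>j\<in>J. \<forall>i'\<in>I. \<forall>j'\<in>J.
      ((i \<cdot>\<^bsub>X\<^esub> i') \<cdot>\<^bsub>X\<^esub> (j \<cdot>\<^bsub>X\<^esub> j')) \<cdot>\<^bsub>X\<^esub> ((i \<cdot>\<^bsub>X\<^esub> j) \<cdot>\<^bsub>X\<^esub> (i' \<cdot>\<^bsub>X\<^esub> j')) \<in> K \<and>
      ((i \<cdot>\<^bsub>X\<^esub> j) \<cdot>\<^bsub>X\<^esub> (i' \<cdot>\<^bsub>X\<^esub> j')) \<cdot>\<^bsub>X\<^esub> ((i \<cdot>\<^bsub>X\<^esub> i') \<cdot>\<^bsub>X\<^esub> (j \<cdot>\<^bsub>X\<^esub> j')) \<in> K)"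
proof -
  interpret I: l_ideal X I by fact
  interpret J: l_ideal X J by fact
  interpret K: l_ideal X K by fact
  have [simp]: "i \<in> carrier X" if "i \<in> I" for i using that I.subset by blast
  have [simp]: "j \<in> carrier X" if "j \<in> J" for j using that J.subset by blast
  have "carrier (l_quot X K) = (\<lambda>x. l_cong X K `` {x}) ` carrier X"
    by (auto simp: l_quot_def quotient_def)
  then show ?thesis
    by (simp add: commutes_modulo_def l_hom_def l_prod_def K.quot_dot K.class_eq_iff
          I.dot_closed Pi_iff I.left_mem J.left_mem)
qed

lemma commutator_least:
  assumes "l_ideal X I" "l_ideal X J"
  shows "l_ideal X (commutator X I J)" "commutes_modulo X I J (commutator X I J)"
    and "\<lbrakk>l_ideal X K; commutes_modulo X I J K\<rbrakk> \<Longrightarrow> commutator X I J \<subseteq> K"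
proof -
  interpret I: l_ideal X I by fact
  interpret J: l_ideal X J by fact
  define F where "F = {K. l_ideal X K \<and> commutes_modulo X I J K}"
  have top: "l_ideal X (carrier X)"
    by unfold_locales (auto simp: I.dot_closed I.one_closed)
  have sub: "i \<in> carrier X" if "i \<in> I \<or> i \<in> J" for i using that I.subset J.subset by blast
  have "carrier X \<in> F"
    by (auto simp: F_def top commutes_modulo_iff[OF assms top] sub I.dot_closed)
  then have ne: "F \<noteq> {}" by blast
  have F: "l_ideal X K" if "K \<in> F" for K using that by (simp add: F_def)
  have id: "l_ideal X (\<Inter>F)"
  proof unfold_locales
    show "\<Inter>F \<subseteq> carrier X" using ne F l_ideal.subset by blast
    show "\<one>\<^bsub>X\<^esub> \<in> \<Inter>F" using F l_ideal.one_mem by blast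
  next
    fix x y
    assume "x \<in> carrier X" "y \<in> carrier X" "x \<in> \<Inter>F" "x \<cdot>\<^bsub>X\<^esub> y \<in> \<Inter>F"
    then show "y \<in> \<Inter>F" by (meson F InterE InterI l_ideal.mp)
  next
    fix x y
    assume "x \<in> \<Inter>F" "y \<in> carrier X"
    then show "(x \<cdot>\<^bsub>X\<^esub> y) \<cdot>\<^bsub>X\<^esub> y \<in> \<Inter>F" "y \<cdot>\<^bsub>X\<^esub> x \<in> \<Inter>F" "y \<cdot>\<^bsub>X\<^esub> (x \<cdot>\<^bsub>X\<^esub> y) \<in> \<Inter>F"
      by (meson F InterE InterI l_ideal.dot_dot_mem l_ideal.left_mem l_ideal.left_dot_mem)+
  qed
  have "commutes_modulo X I J (\<Inter>F)"
    unfolding commutes_modulo_iff[OF assms id]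
    using commutes_modulo_iff[OF assms] by (fastforce simp: F_def)
  with id have P: "l_ideal X (\<Inter>F) \<and> commutes_modulo X I J (\<Inter>F)" by blast
  have L: "commutator X I J = \<Inter>F"
    unfolding commutator_def by (rule Least_equality) (use P in \<open>auto simp: F_def\<close>)
  show "l_ideal X (commutator X I J)" "commutes_modulo X I J (commutator X I J)"
    using P L by auto
  show "commutator X I J \<subseteq> K" if "l_ideal X K" "commutes_modulo X I J K"
    using that L by (auto simp: F_def)
qed

end

(* The morphism condition at the pairs (x, x), (1, x) with x in I \<inter> J reads 1 = x modulo [I, J].
   Conversely, mu is a morphism modulo I \<inter> J: modulo I it is the second projection,
   and modulo J it is constantly 1. *)
theory Submission
  imports Defs
begin

text \<open>The axioms \<open>dot_dot_mem\<close> and \<open>left_dot_mem\<close> are exactly the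
  two halves of this congruence: elements of \<open>I\<close> act from the left like
  \<open>\<one>\<close> modulo \<open>I\<close>.\<close>

lemma (in l_ideal) dot_cong:
  assumes "a \<in> I" "x \<in> carrier X"
  shows "(a \<cdot> x, x) \<in> l_cong X I"
  using assms subset dot_dot_mem left_dot_mem by (auto simp: l_cong_def dot_closed)

lemma l_ideal_Int:
  assumes "l_ideal X I" "l_ideal X J"
  shows "l_ideal X (I \<inter> J)"
proof -
  interpret I: l_ideal X I by fact
  interpret J: l_ideal X J by fact
  show ?thesis
    using I.subset
    by unfold_locales
       (auto intro: I.one_mem J.one_mem I.mp J.mp I.dot_dot_mem J.dot_dot_mem
          I.left_mem J.left_mem I.left_dot_mem J.left_dot_mem)
qed

lemma commutes_modulo_Int:
  assumes "l_ideal X I" "l_ideal X J"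
  shows "commutes_modulo X I J (I \<inter> J)"
  unfolding commutes_modulo_iff[OF assms l_ideal_Int[OF assms]]
proof (intro ballI)
  interpret I: l_ideal X I by fact
  interpret J: l_ideal X J by fact
  fix i j i' j'
  assume ij: "i \<in> I" "j \<in> J" "i' \<in> I" "j' \<in> J"
  then have C: "i \<in> carrier X" "j \<in> carrier X" "i' \<in> carrier X" "j' \<in> carrier X"
    using I.subset J.subset by auto
  let ?l = "(i \<cdot>\<^bsub>X\<^esub> i') \<cdot>\<^bsub>X\<^esub> (j \<cdot>\<^bsub>X\<^esub> j')" and ?r = "(i \<cdot>\<^bsub>X\<^esub> j) \<cdot>\<^bsub>X\<^esub> (i' \<cdot>\<^bsub>X\<^esub> j')"
  have "(?l, j \<cdot>\<^bsub>X\<^esub> j') \<in> l_cong X I"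
    using ij C by (intro I.dot_cong I.left_mem I.dot_closed)
  \<comment> \<open>Here \<open>i\<close> and \<open>i'\<close> are dropped inside the two factors,
    and \<open>cong_dot\<close> combines the results.\<close>
  moreover have "(?r, j \<cdot>\<^bsub>X\<^esub> j') \<in> l_cong X I"
    using ij C by (intro I.cong_dot I.dot_cong)
  ultimately have "(?l, ?r) \<in> l_cong X I"
    using I.equiv_cong by (meson equivE symD transD)
  then have "?l \<cdot>\<^bsub>X\<^esub> ?r \<in> I" "?r \<cdot>\<^bsub>X\<^esub> ?l \<in> I"
    by (auto simp: l_cong_def)
  \<comment> \<open>Modulo \<open>J\<close> the rightmost entry decides: \<open>j'\<close> is in
    \<open>J\<close>, and \<open>left_mem\<close> absorbs every left factor.\<close>
  moreover have "?l \<cdot>\<^bsub>X\<^esub> ?r \<in> J" "?r \<cdot>\<^bsub>X\<^esub> ?l \<in> J"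
    using ij C by (auto intro!: J.left_mem I.dot_closed)
  ultimately show "?l \<cdot>\<^bsub>X\<^esub> ?r \<in> I \<inter> J \<and> ?r \<cdot>\<^bsub>X\<^esub> ?l \<in> I \<inter> J"
    by blast
qed

lemma Int_subset_if_commutes_modulo:
  assumes "l_ideal X I" "l_ideal X J" "l_ideal X K" "commutes_modulo X I J K"
  shows "I \<inter> J \<subseteq> K"
proof
  interpret I: l_ideal X I by fact
  interpret J: l_ideal X J by fact
  fix x assume x: "x \<in> I \<inter> J"
  then have C: "x \<in> carrier X" using I.subset by blast
  \<comment> \<open>Taking \<open>i = j = j' = x\<close> and \<open>i' = \<one>\<close> makes the
    first side \<open>\<one>\<close> and the second \<open>x\<close>, so the whole term equals
    \<open>x\<close>.\<close>
  have "((x \<cdot>\<^bsub>X\<^esub> \<one>\<^bsub>X\<^esub>) \<cdot>\<^bsub>X\<^esub> (x \<cdot>\<^bsub>X\<^esub> x)) \<cdot>\<^bsub>X\<^esub> ((x \<cdot>\<^bsub>X\<^esub> x) \<cdot>\<^bsub>X\<^esub> (\<one>\<^bsub>X\<^esub> \<cdot>\<^bsub>X\<^esub> x)) \<in> K"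
    using assms(4) x I.one_mem unfolding commutes_modulo_iff[OF assms(1-3)] by blast
  then show "x \<in> K"
    using C by (simp add: I.dot_self I.dot_one I.one_dot I.one_closed)
qed

theorem proposition5p1:
  fixes X :: "('a, 'm) l_alg_scheme"  and I J :: "'a set"
  assumes "l_algebra X" and "l_ideal X I" and "l_ideal X J"
  shows "commutator X I J = I \<inter> J"
  \<comment> \<open>Minimality gives one inclusion, since the intersection is itself an admissible
    ideal; the other is the lower bound applied to \<open>K = commutator X I J\<close>.\<close>
  using commutator_least[OF assms(2,3)] l_ideal_Int[OF assms(2,3)]
    commutes_modulo_Int[OF assms(2,3)] Int_subset_if_commutes_modulo[OF assms(2,3)]
  by blast

end
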